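(* There are graphs for which PartialGreedy is strictly better than FullGreedy. Specifically, there is a GNN computation graph $\mathcal G=(L,R,\mathcal E)$, with nodes $A,B,C,D\in L$, such that for $d=2$ and $k=3$ the following hold. The algorithm FullGreedy will choose intermediate nodes in the order $B\oplus C$, $A\oplus B$, $C\oplus D$, arriving at a solution of value $1$. The optimal solution for $k=3$ has value $2$. PartialGreedy will reach this optimal solution of value $2$ even if it chooses the intermediate nodes in the same order as FullGreedy. Here $X\oplus Y$ denotes an intermediate node with in-neighborhood $\{X,Y\}$.
   Context: GNN computation graph. For a directed graph $G=(V,E)$, the GNN computation graph $\mathcal G=(L,R,\mathcal E)$ is the bipartite graph where $L$ and $R$ are copies of $V$ and $(u_L,v_R)\in\mathcal E$ if and only if $(u,v)\in E$. $\Gamma_{in}(v)$ is the set of in-neighbors of $v$ in $\mathcal G$. HAG computation graph. A HAG computation graph for $G$ is a directed acyclic graph $\hat{\mathcal G}=(L\cup M\cup R,\hat{\mathcal E})$, where $L$ and $R$ are copies of $V$ and $M$ is a set of intermediate nodes, with directed edges from $L$ to $M$, from $M$ to $R$, and possibly within $M$ (edges directly from $L$ to $R$ are also permitted), such that for every directed edge $(u,v)\in E$ there is a unique directed path from $u_L$ to $v_R$ in $\hat{\mathcal G}$. $\hat\Gamma_{in}(v)$ and $\hat\Gamma_{out}(v)$ are the sets of in-neighbors and out-neighbors of $v$ in $\hat{\mathcal G}$. If $|\hat\Gamma_{in}(w)|=d$ for all $w\in M$, it is a $d$-HAG computation graph. $\mathcal G$ and $\hat{\mathcal G}$ are equivalent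 if they are computation graphs for the same underlying graph $G$. For a vertex $v$ of $\hat{\mathcal G}$, $\mathrm{cover}(v)$ is the set of $w\in L$ from which there is a directed path to $v$ (so $\mathrm{cover}(v)=\{v\}$ for $v\in L$). It is assumed that distinct $m\in M$ have distinct covers. Equivalence is understood to give that, for $r\in R$, $\Gamma_{in}(r)$ is the disjoint union of the sets $\mathrm{cover}(v)$, $v\in\hat\Gamma_{in}(r)$. Value. The cost of a computation graph with vertex set $\mathcal V$ and right-hand side $R$ is $\mathrm{cost}=c_{Agg}\sum_{w\in\mathcal V}(|\text{in-neighbors of }w|-1)+c_{Up}|R|$, where $c_{Agg},c_{Up}$ are constants (costs of an aggregation and an update). For $\hat{\mathcal G}$ equivalent to $\mathcal G$, $$\mathrm{value}(\hat{\mathcal G})=\frac1{c_{Agg}}\left(\mathrm{cost}(\mathcal G)-\mathrm{cost}(\hat{\mathcal G})\right)=\sum_{v\in M}\left[|\hat\Gamma_{out}(v)|(|\mathrm{cover}(v)|-1)-(|\hat\Gamma_{in}(v)|-1)\right].$$ Optimal solution. The $d$-HAG problem with node budget $k$ is: given $G$, find a HAG computation graph for $G$ of largest value subject to $|M|\le k$ and $|\hat\Gamma_{in}(w)|=d$ for all $w\in M$. FullGreedy, input $\mathcal G,k,d$. Start with $M_0=\emptyset$, $\hat{\mathcal E}_0=\mathcal E$. For $i=1,\dots,k$: let $C$ be a subset of $L\cup M_{i-1}$ with $|C|=d$ maximizing $|\bigcap_{v\in C}\hat\Gamma_{out}(v)\cap R|$ (out-neighborhoods in the current graph), and let $R_C=\bigcap_{v\in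 C}\hat\Gamma_{out}(v)\cap R$. Set $M_i=M_{i-1}\cup\{v_i\}$ with $v_i$ new. Obtain $\hat{\mathcal E}_i$ from $\hat{\mathcal E}_{i-1}$ by adding $(\ell,v_i)$ for all $\ell\in C$, adding $(v_i,r)$ for all $r\in R_C$, and removing all edges $(\ell,r)$ with $\ell\in C$, $r\in R_C$. The output is $\hat{\mathcal G}_k=(L\cup M_k\cup R,\hat{\mathcal E}_k)$. PartialGreedy, input $\mathcal G,k,d$. Let $T_{\hat{\mathcal G}}(L,M)$ be the set of edges of $\hat{\mathcal G}$ from $L$ to $M$ or within $M$. Start with $M_0=\emptyset$, $\hat{\mathcal G}_0=(L\cup R,\mathcal E)$. For $i=1,\dots,k$: for every $C\subseteq L\cup M_{i-1}$ with $|C|=d$, let $M_i=M_{i-1}\cup\{v_i\}$ with $v_i$ new. Let $\mathcal S_C$ be the set of $d$-HAG computation graphs $\hat{\mathcal G}^{(C)}$ on $L\cup M_i\cup R$ equivalent to $\mathcal G$ with $T_{\hat{\mathcal G}^{(C)}}(L,M_i)=T_{\hat{\mathcal G}_{i-1}}(L,M_{i-1})\cup(C\times\{v_i\})$, and let $\hat{\mathcal G}^{(C)}_{opt}$ be a maximum value element of $\mathcal S_C$. Then let $\hat{\mathcal G}_i$ be of maximum value among the $\hat{\mathcal G}^{(C)}_{opt}$. The output is $\hat{\mathcal G}_k$. *)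

theory Defs
  imports Complex_Main "Graph_Theory.Pair_Digraph"
begin

section \<open>Computation graphs\<close>

text \<open>\<open>LNode v\<close> and \<open>RNode v\<close> are the two copies of a vertex \<open>v\<close>. Intermediate nodes carry
  natural number labels, which is no restriction, as there are only finitely many of them.\<close>

datatype 'v node = LNode 'v | MNode nat | RNode 'v

type_synonym 'v cgraph = "'v node pair_pre_digraph"

definition lefts :: "'v cgraph \<Rightarrow> 'v node set" where
  "lefts H = pverts H \<inter> range LNode"

definition mids :: "'v cgraph \<Rightarrow> 'v node set" where
  "mids H = pverts H \<inter> range MNode"

definition rights :: "'v cgraph \<Rightarrow> 'v node set" where
  "rights H = pverts H \<inter> range RNode"

definition in_nbrs :: "'v cgraph \<Rightarrow> 'v node \<Rightarrow> 'v node set" where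
  "in_nbrs H w = {u. (u, w) \<in> parcs H}"

definition out_nbrs :: "'v cgraph \<Rightarrow> 'v node \<Rightarrow> 'v node set" where
  "out_nbrs H u = {w. (u, w) \<in> parcs H}"

definition cover :: "'v cgraph \<Rightarrow> 'v node \<Rightarrow> 'v node set" where
  "cover H v = {w \<in> lefts H. w \<rightarrow>\<^sup>*\<^bsub>with_proj H\<^esub> v}"

definition gnn_graph :: "'v pair_pre_digraph \<Rightarrow> 'v cgraph" where
  "gnn_graph G = \<lparr> pverts = LNode ` pverts G \<union> RNode ` pverts G,
                   parcs = {(LNode u, RNode v) |u v. (u, v) \<in> parcs G} \<rparr>"

text \<open>The unique path condition speaks about the arcs \<open>(u, v)\<close> of \<open>G\<close> only; the next condition
  (the in-neighborhood of every right node in the GNN computation graph is the disjoint union of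
  the covers of its in-neighbors) also rules out paths from \<open>LNode u\<close> to \<open>RNode v\<close> when \<open>(u, v)\<close>
  is not an arc.\<close>

definition hag_graph :: "'v pair_pre_digraph \<Rightarrow> 'v cgraph \<Rightarrow> bool" where
  "hag_graph G H \<longleftrightarrow>
     pair_fin_digraph H \<and>
     lefts H = LNode ` pverts G \<and>
     rights H = RNode ` pverts G \<and>
     parcs H \<subseteq> (lefts H \<union> mids H) \<times> (mids H \<union> rights H) \<and>
     acyclic (parcs H) \<and>
     (\<forall>u v. (u, v) \<in> parcs G \<longrightarrow>
        (\<exists>!p. pre_digraph.apath (with_proj H) (LNode u) p (RNode v))) \<and>
     (\<forall>r \<in> rights H.
        (\<forall>v \<in> in_nbrs H r. \<forall>w \<in> in_nbrs H r. v \<noteq> w \<longrightarrow> cover H v \<inter> cover H w = {}) \<and>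
        in_nbrs (gnn_graph G) r = (\<Union>v \<in> in_nbrs H r. cover H v)) \<and>
     inj_on (cover H) (mids H)"

definition d_hag_graph :: "'v pair_pre_digraph \<Rightarrow> nat \<Rightarrow> 'v cgraph \<Rightarrow> bool" where
  "d_hag_graph G d H \<longleftrightarrow> hag_graph G H \<and> (\<forall>w \<in> mids H. card (in_nbrs H w) = d)"


section \<open>Cost, value, and optimal solutions\<close>

definition cost :: "real \<Rightarrow> real \<Rightarrow> 'v cgraph \<Rightarrow> real" where
  "cost cAgg cUp H =
     cAgg * (\<Sum>w \<in> pverts H. real (card (in_nbrs H w)) - 1) + cUp * real (card (rights H))"

text \<open>The value is the normalised cost difference. It equals the sum over the intermediate nodes
  \<open>v\<close> of \<open>out(v) * (card (cover v) - 1) - (card (in_nbrs v) - 1)\<close> where \<open>out(v)\<close> has to count the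
  out-neighbors of \<open>v\<close> in the right-hand side only (arcs between intermediate nodes must not be
  counted).\<close>

definition hag_value :: "real \<Rightarrow> real \<Rightarrow> 'v pair_pre_digraph \<Rightarrow> 'v cgraph \<Rightarrow> real" where
  "hag_value cAgg cUp G H = (1 / cAgg) * (cost cAgg cUp (gnn_graph G) - cost cAgg cUp H)"

definition feasible_hag :: "'v pair_pre_digraph \<Rightarrow> nat \<Rightarrow> nat \<Rightarrow> 'v cgraph \<Rightarrow> bool" where
  "feasible_hag G d k H \<longleftrightarrow> d_hag_graph G d H \<and> card (mids H) \<le> k"

definition optimal_hag ::
  "real \<Rightarrow> real \<Rightarrow> 'v pair_pre_digraph \<Rightarrow> nat \<Rightarrow> nat \<Rightarrow> 'v cgraph \<Rightarrow> bool" where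
  "optimal_hag cAgg cUp G d k H \<longleftrightarrow> is_arg_max (hag_value cAgg cUp G) (feasible_hag G d k) H"


section \<open>The greedy algorithms\<close>

text \<open>Both algorithms leave open how ties are broken, so they are modelled as relations:
  \<open>full_greedy G d k Cs H\<close> says that some run of \<open>k\<close> iterations picks the sets \<open>Cs ! 0\<close>,
  \<open>Cs ! 1\<close>, \dots, in this order, as in-neighborhoods of the new nodes and outputs \<open>H\<close>. The node
  added in iteration \<open>i\<close> is \<open>MNode i\<close>.\<close>

definition candidate :: "nat \<Rightarrow> 'v cgraph \<Rightarrow> 'v node set \<Rightarrow> bool" where
  "candidate d H C \<longleftrightarrow> C \<subseteq> lefts H \<union> mids H \<and> card C = d"

definition common_rights :: "'v cgraph \<Rightarrow> 'v node set \<Rightarrow> 'v node set" where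
  "common_rights H C = (\<Inter>v \<in> C. out_nbrs H v) \<inter> rights H"

definition add_mid :: "'v cgraph \<Rightarrow> 'v node \<Rightarrow> 'v node set \<Rightarrow> 'v cgraph" where
  "add_mid H m C =
     \<lparr> pverts = insert m (pverts H),
       parcs = (parcs H - C \<times> common_rights H C) \<union> C \<times> {m} \<union> {m} \<times> common_rights H C \<rparr>"

inductive full_greedy ::
  "'v pair_pre_digraph \<Rightarrow> nat \<Rightarrow> nat \<Rightarrow> 'v node set list \<Rightarrow> 'v cgraph \<Rightarrow> bool"
  for G :: "'v pair_pre_digraph" and d :: nat where
  start: "full_greedy G d 0 [] (gnn_graph G)"
| step: "full_greedy G d (Suc i) (Cs @ [C]) (add_mid H (MNode (Suc i)) C)"
    if "full_greedy G d i Cs H"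
      and "is_arg_max (\<lambda>C'. card (common_rights H C')) (candidate d H) C"

definition mid_arcs :: "'v cgraph \<Rightarrow> ('v node \<times> 'v node) set" where
  "mid_arcs H = parcs H \<inter> (lefts H \<union> mids H) \<times> mids H"

text \<open>The set \<open>\<S>\<^sub>C\<close>: graphs extending the chosen upper part of \<open>H\<close> by a new node \<open>m\<close> with
  in-neighborhood \<open>C\<close>, the arcs into the right-hand side being arbitrary.\<close>

definition extensions ::
  "'v pair_pre_digraph \<Rightarrow> nat \<Rightarrow> 'v cgraph \<Rightarrow> 'v node \<Rightarrow> 'v node set \<Rightarrow> 'v cgraph set" where
  "extensions G d H m C =
     {H'. d_hag_graph G d H' \<and> mids H' = insert m (mids H) \<and>
          mid_arcs H' = mid_arcs H \<union> C \<times> {m}}"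

text \<open>\<open>extensions\<close> can be empty, e.g. if the cover of the new node would coincide with that of an
  old one; such \<open>C\<close> are skipped. \<open>opt\<close> is the choice of a best element for each remaining \<open>C\<close>.\<close>

inductive partial_greedy ::
  "real \<Rightarrow> real \<Rightarrow> 'v pair_pre_digraph \<Rightarrow> nat \<Rightarrow> nat \<Rightarrow> 'v node set list \<Rightarrow> 'v cgraph \<Rightarrow> bool"
  for cAgg cUp :: real and G :: "'v pair_pre_digraph" and d :: nat where
  start: "partial_greedy cAgg cUp G d 0 [] (gnn_graph G)"
| step: "partial_greedy cAgg cUp G d (Suc i) (Cs @ [C]) (opt C)"
    if "partial_greedy cAgg cUp G d i Cs H"
      and "\<And>C'. candidate d H C' \<Longrightarrow> extensions G d H (MNode (Suc i)) C' \<noteq> {} \<Longrightarrow>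
             is_arg_max (hag_value cAgg cUp G)
               (\<lambda>H'. H' \<in> extensions G d H (MNode (Suc i)) C') (opt C')"
      and "is_arg_max (\<lambda>C'. hag_value cAgg cUp G (opt C'))
             (\<lambda>C'. candidate d H C' \<and> extensions G d H (MNode (Suc i)) C' \<noteq> {}) C"

end

theory Submission
  imports Defs
begin

text \<open>With \<open>A, B, C, D\<close> the left copies of \<open>0, 1, 2, 3\<close>, the example has the nonempty in-neighborhoods
  \<open>{A, B, C, D}\<close>, \<open>{A, B}\<close>, \<open>{C, D}\<close>, \<open>{B, C}\<close>. FullGreedy feeds \<open>B \<oplus> C\<close> into the right node with
  four in-neighbors, after which \<open>A \<oplus> B\<close> and \<open>C \<oplus> D\<close> serve one right node each. Feeding \<open>A \<oplus> B\<close> and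
  \<open>C \<oplus> D\<close> into it instead saves one more arc.

  For \<open>d = 2\<close> the value is the number of arcs saved at the right nodes minus the number of intermediate
  nodes. The right node with four in-neighbors saves two arcs if it keeps two in-arcs, and every further
  saving requires a right node with a single in-arc. The source of that arc is an intermediate node
  whose cover is the whole in-neighborhood; as these covers are distinct, there are at most as many
  such right nodes as intermediate nodes. So the value is at most \<open>2\<close>.\<close>

subsection \<open>In-neighborhoods, covers and savings\<close>

definition nbrs :: "'v pair_pre_digraph \<Rightarrow> 'v \<Rightarrow> 'v set" where
  "nbrs G r = {u. (u, r) \<in> parcs G}"

definition saving :: "'v pair_pre_digraph \<Rightarrow> 'v cgraph \<Rightarrow> 'v \<Rightarrow> real" where
  "saving G H r = real (card (nbrs G r)) - real (card (in_nbrs H (RNode r)))"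

lemma pverts_cgraph: "pverts H = lefts H \<union> mids H \<union> rights H"
  unfolding lefts_def mids_def rights_def by (auto intro: node.exhaust) (metis node.exhaust rangeI)

lemma disjoint_sides:
  "lefts H \<inter> mids H = {}" "lefts H \<inter> rights H = {}" "mids H \<inter> rights H = {}"
  unfolding lefts_def mids_def rights_def by auto

lemma gnn_graph_simps [simp]:
  "lefts (gnn_graph G) = LNode ` pverts G"
  "mids (gnn_graph G) = {}"
  "rights (gnn_graph G) = RNode ` pverts G"
  unfolding lefts_def mids_def rights_def gnn_graph_def by auto

lemma in_nbrs_gnn_graph [simp]:
  "in_nbrs (gnn_graph G) (RNode r) = LNode ` nbrs G r"
  "in_nbrs (gnn_graph G) (LNode u) = {}"
  unfolding in_nbrs_def gnn_graph_def nbrs_def by auto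

lemma card_image_LNode [simp]: "card (LNode ` A) = card A"
  by (simp add: card_image inj_on_def)

lemma card_image_RNode [simp]: "card (RNode ` A) = card A"
  by (simp add: card_image inj_on_def)

lemma card_image_MNode [simp]: "card (MNode ` A) = card A"
  by (simp add: card_image inj_on_def)

text \<open>Left nodes contribute \<open>-1\<close> each to both sums and the update costs agree, so
  these terms cancel. What remains are the in-degree differences at the right nodes and
  \<open>d - 1\<close> for each intermediate node.\<close>

lemma hag_value_eq_savings:
  assumes "cAgg \<noteq> 0" and G: "finite (pverts G)" and H: "d_hag_graph G d H"
  shows "hag_value cAgg cUp G H
    = (\<Sum>r\<in>pverts G. saving G H r) - real (card (mids H)) * (real d - 1)"
proof -
  have hag: "hag_graph G H" and d: "\<And>w. w \<in> mids H \<Longrightarrow> card (in_nbrs H w) = d"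
    using H by (auto simp: d_hag_graph_def)
  have L: "lefts H = LNode ` pverts G" and R: "rights H = RNode ` pverts G"
    and arcs: "parcs H \<subseteq> (lefts H \<union> mids H) \<times> (mids H \<union> rights H)"
    and fin: "finite (pverts H)"
    using hag by (auto simp: hag_graph_def pair_fin_digraph_def pair_fin_digraph_axioms_def)
  have finM: "finite (mids H)" using fin by (simp add: mids_def)
  have inj: "inj_on LNode A" "inj_on RNode A" for A :: "'a set"
    by (auto simp: inj_on_def)
  have no_in: "in_nbrs H (LNode u) = {}" for u
    using arcs unfolding in_nbrs_def mids_def rights_def by auto
  have "(\<Sum>w \<in> pverts H. real (card (in_nbrs H w)) - 1)
    = (\<Sum>w \<in> lefts H \<union> mids H. real (card (in_nbrs H w)) - 1)
      + (\<Sum>w \<in> rights H. real (card (in_nbrs H w)) - 1)"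
    unfolding pverts_cgraph using disjoint_sides[of H] L R G finM
    by (intro sum.union_disjoint) auto
  also have "(\<Sum>w \<in> lefts H \<union> mids H. real (card (in_nbrs H w)) - 1)
    = (\<Sum>w \<in> lefts H. real (card (in_nbrs H w)) - 1)
      + (\<Sum>w \<in> mids H. real (card (in_nbrs H w)) - 1)"
    using disjoint_sides[of H] L G finM by (intro sum.union_disjoint) auto
  also have "(\<Sum>w \<in> lefts H. real (card (in_nbrs H w)) - 1) = - real (card (pverts G))"
    unfolding L by (simp add: sum.reindex inj no_in)
  also have "(\<Sum>w \<in> mids H. real (card (in_nbrs H w)) - 1)
    = real (card (mids H)) * (real d - 1)"
    by (simp add: d)
  also have "(\<Sum>w \<in> rights H. real (card (in_nbrs H w)) - 1)
    = (\<Sum>r\<in>pverts G. real (card (in_nbrs H (RNode r))) - 1)"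
    unfolding R by (simp add: sum.reindex inj)
  finally have H_sum: "(\<Sum>w \<in> pverts H. real (card (in_nbrs H w)) - 1)
    = - real (card (pverts G)) + real (card (mids H)) * (real d - 1)
      + (\<Sum>r\<in>pverts G. real (card (in_nbrs H (RNode r))) - 1)" .
  have "pverts (gnn_graph G) = LNode ` pverts G \<union> RNode ` pverts G"
    by (simp add: gnn_graph_def)
  then have "(\<Sum>w \<in> pverts (gnn_graph G). real (card (in_nbrs (gnn_graph G) w)) - 1)
    = (\<Sum>w \<in> LNode ` pverts G. real (card (in_nbrs (gnn_graph G) w)) - 1)
      + (\<Sum>w \<in> RNode ` pverts G. real (card (in_nbrs (gnn_graph G) w)) - 1)"
    using G by (simp, intro sum.union_disjoint) auto
  also have "\<dots> = - real (card (pverts G)) + (\<Sum>r\<in>pverts G. real (card (nbrs G r)) - 1)"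
    by (simp add: sum.reindex inj)
  finally have G_sum: "(\<Sum>w \<in> pverts (gnn_graph G). real (card (in_nbrs (gnn_graph G) w)) - 1)
    = - real (card (pverts G)) + (\<Sum>r\<in>pverts G. real (card (nbrs G r)) - 1)" .
  have "card (rights H) = card (pverts G)" by (simp add: R)
  then show ?thesis using \<open>cAgg \<noteq> 0\<close>
    unfolding hag_value_def cost_def H_sum G_sum
    by (simp add: field_simps saving_def sum_subtractf)
qed

lemma cover_LNode:
  assumes "hag_graph G H" and "LNode u \<in> lefts H"
  shows "cover H (LNode u) = {LNode u}"
proof -
  have no_in: "(x, LNode u) \<notin> parcs H" for x
    using assms(1) unfolding hag_graph_def mids_def rights_def by auto
  have "w = LNode u" if "w \<rightarrow>\<^sup>*\<^bsub>with_proj H\<^esub> LNode u" for w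
    using that no_in unfolding reachable_def by (cases rule: rtrancl_on.cases) auto
  then show ?thesis
    using assms(2) by (auto simp: cover_def lefts_def reachable_def)
qed

text \<open>As \<open>m\<close> is not a left node, every path from a left node to \<open>m\<close>
  is nontrivial and can be split before its last arc.\<close>

lemma cover_MNode:
  assumes "hag_graph G H" and "m \<in> mids H"
  shows "cover H m = (\<Union>v \<in> in_nbrs H m. cover H v)"
proof -
  have verts: "x \<in> pverts H" "y \<in> pverts H" if "(x, y) \<in> parcs H" for x y
    using assms(1) that unfolding hag_graph_def lefts_def mids_def rights_def by auto
  have "m \<notin> lefts H" using assms(2) disjoint_sides(1) by blast
  then have "w \<in> cover H m \<longleftrightarrow> w \<in> (\<Union>v \<in> in_nbrs H m. cover H v)" for w
    unfolding cover_def reachable_def in_nbrs_def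
    by (auto elim: rtrancl_on.cases intro: rtrancl_on_into_rtrancl_on dest: verts)
  then show ?thesis by blast
qed

text \<open>Membership in \<open>extensions\<close> fixes \<open>mid_arcs\<close>; it thereby fixes
  the in-neighborhoods of the intermediate nodes, and with them their covers.\<close>

lemma in_nbrs_mid:
  assumes "hag_graph G H" and "m \<in> mids H"
  shows "in_nbrs H m = {u. (u, m) \<in> mid_arcs H}"
  using assms unfolding hag_graph_def in_nbrs_def mid_arcs_def by auto

section \<open>Savings at the right nodes of an arbitrary HAG computation graph\<close>

context
  fixes G :: "'v pair_pre_digraph" and H :: "'v cgraph"
  assumes G: "pair_fin_digraph G" and H: "hag_graph G H"
begin

lemma finite_lefts: "finite (lefts H)"
  and finite_mids: "finite (mids H)"
proof -
  have "pair_fin_digraph H" using H by (simp add: hag_graph_def)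
  then show "finite (lefts H)" "finite (mids H)"
    by (simp_all add: lefts_def mids_def pair_fin_digraph.pair_finite_verts)
qed

lemma finite_cover: "finite (cover H v)"
  using finite_lefts by (simp add: cover_def)

lemma in_nbrs_subset: "in_nbrs H r \<subseteq> lefts H \<union> mids H"
  using H by (auto simp: hag_graph_def in_nbrs_def)

lemma finite_in_nbrs: "finite (in_nbrs H r)"
  using in_nbrs_subset finite_lefts finite_mids by (rule finite_subset[OF _ finite_UnI])

lemma card_cover_left: "v \<in> lefts H \<Longrightarrow> card (cover H v) = 1"
  using cover_LNode[OF H] by (auto simp: lefts_def)

context
  fixes r :: 'v
  assumes r: "r \<in> pverts G"
begin

lemma Union_cover_in_nbrs: "(\<Union>v \<in> in_nbrs H (RNode r). cover H v) = LNode ` nbrs G r"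
  using H r unfolding hag_graph_def by (metis imageI in_nbrs_gnn_graph(1))

lemma cover_in_nbrs_disjoint:
  assumes "v \<in> in_nbrs H (RNode r)" "w \<in> in_nbrs H (RNode r)" "v \<noteq> w"
  shows "cover H v \<inter> cover H w = {}"
  using H r assms unfolding hag_graph_def by blast

lemma card_nbrs: "card (nbrs G r) = (\<Sum>v \<in> in_nbrs H (RNode r). card (cover H v))"
proof -
  have "card (\<Union>v \<in> in_nbrs H (RNode r). cover H v)
      = (\<Sum>v \<in> in_nbrs H (RNode r). card (cover H v))"
    using cover_in_nbrs_disjoint finite_in_nbrs finite_cover by (intro card_UN_disjoint) auto
  then show ?thesis by (simp add: Union_cover_in_nbrs)
qed

text \<open>The covers of the in-neighbors partition the in-neighborhood of \<open>r\<close>, and a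
  left in-neighbor, whose cover is a singleton, contributes zero.\<close>

lemma saving_eq_sum_mids:
  "saving G H r = (\<Sum>m \<in> in_nbrs H (RNode r) \<inter> mids H. real (card (cover H m)) - 1)"
proof -
  have "saving G H r = (\<Sum>v \<in> in_nbrs H (RNode r). real (card (cover H v)) - 1)"
    by (simp add: saving_def card_nbrs sum_subtractf)
  also have "\<dots> = (\<Sum>m \<in> in_nbrs H (RNode r) \<inter> mids H. real (card (cover H m)) - 1)"
    using in_nbrs_subset[of "RNode r"] finite_in_nbrs card_cover_left
    by (intro sum.mono_neutral_right) auto
  finally show ?thesis .
qed

lemma in_nbrs_nonempty: "nbrs G r \<noteq> {} \<Longrightarrow> card (in_nbrs H (RNode r)) \<ge> 1"
  using Union_cover_in_nbrs finite_in_nbrs[of "RNode r"] by (auto simp: Suc_le_eq card_gt_0_iff)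

end

text \<open>The only in-neighbor has to cover the whole in-neighborhood, whereas a left node covers
  just one node.\<close>

lemma single_in_nbr:
  assumes "r \<in> pverts G" and "card (nbrs G r) \<ge> 2" and "card (in_nbrs H (RNode r)) = 1"
  obtains m where "m \<in> mids H" and "cover H m = LNode ` nbrs G r"
proof -
  obtain m where m: "in_nbrs H (RNode r) = {m}" using assms(3) by (meson card_1_singletonE)
  have cov: "cover H m = LNode ` nbrs G r" using Union_cover_in_nbrs[OF assms(1)] m by simp
  then have "m \<notin> lefts H" using card_cover_left[of m] assms(2) by auto
  then have "m \<in> mids H" using in_nbrs_subset[of "RNode r"] m by auto
  with cov that show thesis by blast
qed

text \<open>The cover of the intermediate node that alone feeds \<open>r\<close> is the
  in-neighborhood of \<open>r\<close> and so determines \<open>r\<close>. This gives an injection of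
  \<open>S\<close> into \<open>mids H\<close>.\<close>

lemma card_single_in_nbr_le:
  assumes "inj_on (nbrs G) S" and S: "S \<subseteq> pverts G"
    and "\<And>r. r \<in> S \<Longrightarrow> card (nbrs G r) \<ge> 2 \<and> card (in_nbrs H (RNode r)) = 1"
  shows "card S \<le> card (mids H)"
proof -
  have "\<exists>m. m \<in> mids H \<and> cover H m = LNode ` nbrs G r" if "r \<in> S" for r
    by (rule single_in_nbr[of r]) (use assms(3)[OF that] S that in auto)
  then obtain f where f: "\<And>r. r \<in> S \<Longrightarrow> f r \<in> mids H \<and> cover H (f r) = LNode ` nbrs G r"
    by metis
  have "inj_on f S"
  proof (rule inj_onI)
    fix q r assume "q \<in> S" "r \<in> S" "f q = f r"
    then have "LNode ` nbrs G q = LNode ` nbrs G r" using f by metis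
    then have "nbrs G q = nbrs G r" by (simp add: inj_image_eq_iff inj_on_def)
    then show "q = r" using assms(1) \<open>q \<in> S\<close> \<open>r \<in> S\<close> by (simp add: inj_on_def)
  qed
  then show ?thesis using f finite_mids by (meson card_inj_on_le image_subsetI)
qed

end

subsection \<open>HAG computation graphs without arcs between intermediate nodes\<close>

text \<open>A direct arc from \<open>u\<close> to \<open>r\<close> is kept exactly when no
  intermediate node feeding \<open>r\<close> covers \<open>u\<close>. With \<open>c\<close> and
  \<open>s\<close> fixed, enlarging \<open>I\<close> describes the successive stages of a
  run.\<close>

definition flat_graph ::
  "'v pair_pre_digraph \<Rightarrow> (nat \<Rightarrow> 'v set) \<Rightarrow> ('v \<Rightarrow> nat set) \<Rightarrow> nat set \<Rightarrow> 'v cgraph" where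
  "flat_graph G c s I =
     \<lparr> pverts = LNode ` pverts G \<union> MNode ` I \<union> RNode ` pverts G,
       parcs = {(LNode u, MNode i) |u i. i \<in> I \<and> u \<in> c i}
         \<union> {(MNode i, RNode r) |i r. r \<in> pverts G \<and> i \<in> I \<inter> s r}
         \<union> {(LNode u, RNode r) |u r. (u, r) \<in> parcs G \<and> u \<notin> (\<Union>i \<in> I \<inter> s r. c i)} \<rparr>"

lemma flat_graph_simps [simp]:
  "lefts (flat_graph G c s I) = LNode ` pverts G"
  "mids (flat_graph G c s I) = MNode ` I"
  "rights (flat_graph G c s I) = RNode ` pverts G"
  unfolding lefts_def mids_def rights_def flat_graph_def by auto

lemma parcs_flat_graph [simp]:
  "(LNode u, MNode i) \<in> parcs (flat_graph G c s I) \<longleftrightarrow> i \<in> I \<and> u \<in> c i"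
  "(MNode i, RNode r) \<in> parcs (flat_graph G c s I) \<longleftrightarrow> r \<in> pverts G \<and> i \<in> I \<and> i \<in> s r"
  "(LNode u, RNode r) \<in> parcs (flat_graph G c s I)
     \<longleftrightarrow> (u, r) \<in> parcs G \<and> u \<notin> (\<Union>i \<in> I \<inter> s r. c i)"
  "(x, LNode u) \<notin> parcs (flat_graph G c s I)"
  "(RNode r, x) \<notin> parcs (flat_graph G c s I)"
  "(MNode i, MNode j) \<notin> parcs (flat_graph G c s I)"
  unfolding flat_graph_def by auto

lemma flat_graph_empty: "flat_graph G c s {} = gnn_graph G"
  unfolding flat_graph_def gnn_graph_def by auto

lemma mid_arcs_flat_graph:
  "(\<Union>i \<in> I. c i) \<subseteq> pverts G
    \<Longrightarrow> mid_arcs (flat_graph G c s I) = (\<Union>i \<in> I. (LNode ` c i) \<times> {MNode i})"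
  unfolding mid_arcs_def flat_graph_simps by (auto simp: flat_graph_def)

text \<open>If the right nodes that FullGreedy reroutes are those that \<open>s\<close> assigns to
  \<open>j\<close>, then one iteration just adds the label \<open>j\<close>.\<close>

lemma add_mid_flat_graph:
  assumes "common_rights (flat_graph G c s I) (LNode ` c j) = RNode ` {r \<in> pverts G. j \<in> s r}"
    and "j \<notin> I" and "pair_fin_digraph G"
  shows "add_mid (flat_graph G c s I) (MNode j) (LNode ` c j) = flat_graph G c s (insert j I)"
proof -
  have "r \<in> pverts G" if "(u, r) \<in> parcs G" for u r
    using assms(3) that
    by (metis pair_fin_digraph_def pair_wf_digraph.arc_snd_in_verts snd_conv)
  then show ?thesis
    unfolding add_mid_def assms(1) using assms(2) by (auto simp: flat_graph_def)
qed

text \<open>\<open>c i\<close> is the in-neighborhood of the intermediate node \<open>i\<close>, and \<open>s r\<close> contains the intermediate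
  nodes that feed \<open>r\<close>; labels outside \<open>I\<close> are ignored.\<close>

locale flat_hag =
  fixes G :: "'v pair_pre_digraph" and c :: "nat \<Rightarrow> 'v set" and s :: "'v \<Rightarrow> nat set"
    and I :: "nat set"
  assumes G: "pair_fin_digraph G"
    and finite_I: "finite I"
    and c_verts: "i \<in> I \<Longrightarrow> c i \<subseteq> pverts G"
    and c_inj: "inj_on c I"
    and c_nbrs: "r \<in> pverts G \<Longrightarrow> i \<in> I \<Longrightarrow> i \<in> s r \<Longrightarrow> c i \<subseteq> nbrs G r"
    and c_disjoint: "r \<in> pverts G \<Longrightarrow> i \<in> I \<Longrightarrow> i \<in> s r \<Longrightarrow> j \<in> I \<Longrightarrow> j \<in> s r \<Longrightarrow> i \<noteq> j
      \<Longrightarrow> c i \<inter> c j = {}"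
begin

lemma c_vertsD: "i \<in> I \<Longrightarrow> u \<in> c i \<Longrightarrow> u \<in> pverts G"
  using c_verts by blast

abbreviation "F \<equiv> flat_graph G c s I"

lemma arcs_G: "(u, r) \<in> parcs G \<Longrightarrow> u \<in> pverts G \<and> r \<in> pverts G"
  using G by (metis fst_conv pair_fin_digraph_def pair_wf_digraph_def snd_conv)

lemma arcs_F:
  assumes "(x, y) \<in> parcs F"
  obtains (LM) u i where "x = LNode u" "y = MNode i" "i \<in> I" "u \<in> c i"
  | (MR) i r where "x = MNode i" "y = RNode r" "i \<in> I" "i \<in> s r" "r \<in> pverts G"
  | (LR) u r where "x = LNode u" "y = RNode r" "(u, r) \<in> parcs G" "u \<notin> (\<Union>i \<in> I \<inter> s r. c i)"
  using assms unfolding flat_graph_def by auto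

lemma pverts_F: "pverts F = LNode ` pverts G \<union> MNode ` I \<union> RNode ` pverts G"
  by (simp add: flat_graph_def)

lemma arcs_F_verts: "(x, y) \<in> parcs F \<Longrightarrow> x \<in> pverts F \<and> y \<in> pverts F"
  unfolding pverts_F by (elim arcs_F) (auto dest: c_vertsD arcs_G)

lemma fin_F: "pair_fin_digraph F"
proof
  show fin: "finite (pverts F)"
    using finite_I G by (simp add: pverts_F pair_fin_digraph.pair_finite_verts)
  have "parcs F \<subseteq> pverts F \<times> pverts F" using arcs_F_verts by auto
  then show "finite (parcs F)" using fin finite_subset by blast
qed (use arcs_F_verts in \<open>metis prod.collapse\<close>)+

lemma acyclic_F: "acyclic (parcs F)"
proof (rule acyclicI_order)
  fix x y assume "(x, y) \<in> parcs F"
  then show "(case y of LNode u \<Rightarrow> 2 | MNode i \<Rightarrow> 1 | RNode r \<Rightarrow> 0)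
      < (case x of LNode u \<Rightarrow> 2 | MNode i \<Rightarrow> 1 | RNode r \<Rightarrow> (0 :: nat))"
    by (elim arcs_F) auto
qed

text \<open>Without arcs between intermediate nodes, a path from left to right has one or two
  arcs.\<close>

lemma apath_F_iff:
  "pre_digraph.apath (with_proj F) (LNode u) p (RNode r) \<longleftrightarrow>
     p = [(LNode u, RNode r)] \<and> (LNode u, RNode r) \<in> parcs F \<or>
     (\<exists>i \<in> I. p = [(LNode u, MNode i), (MNode i, RNode r)] \<and> u \<in> c i \<and> i \<in> s r \<and> r \<in> pverts G)"
  (is "?L \<longleftrightarrow> ?R")
proof
  assume ?L
  then have arcs: "set p \<subseteq> parcs F" and cas: "pcas (LNode u) p (RNode r)"
    by (auto simp: pre_digraph.apath_def pre_digraph.awalk_def cas_with_proj_eq)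
  from cas obtain y q where p: "p = (LNode u, y) # q" and q: "pcas y q (RNode r)"
    by (cases p) auto
  \<comment> \<open>Right nodes have no out-arcs, so a path stops at the first right node.\<close>
  have R: "q = []" if "pcas (RNode t) q (RNode r)" "set q \<subseteq> parcs F" for q t
    using that by (cases q) auto
  have "(LNode u, y) \<in> parcs F" using arcs p by auto
  then show ?R
  proof (cases rule: arcs_F)
    case (LM u' i)
    with q obtain z q' where q': "q = (MNode i, z) # q'" "pcas z q' (RNode r)"
      by (cases q) auto
    then have "(MNode i, z) \<in> parcs F" using arcs p by auto
    then show ?thesis
    proof (cases rule: arcs_F)
      case (MR i' r')
      then have "q' = []" using R[of r' q'] q' arcs p by auto
      then show ?thesis using LM MR p q' by auto
    qed auto
  next
    case (LR u' r')
    then have "q = []" using R[of r' q] q arcs p by auto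
    then show ?thesis using LR p q \<open>(LNode u, y) \<in> parcs F\<close> by auto
  qed auto
next
  assume ?R
  then show ?L
    using c_verts
    by (auto simp: pre_digraph.apath_def pre_digraph.awalk_def cas_with_proj_eq
        awalk_verts_with_proj_eq pverts_F dest: arcs_G)
qed

lemma in_nbrs_F:
  "i \<in> I \<Longrightarrow> in_nbrs F (MNode i) = LNode ` c i"
  "r \<in> pverts G \<Longrightarrow> in_nbrs F (RNode r)
     = MNode ` (I \<inter> s r) \<union> LNode ` (nbrs G r - (\<Union>i \<in> I \<inter> s r. c i))"
  unfolding in_nbrs_def nbrs_def flat_graph_def by auto

text \<open>Covers are computed directly from the arcs here: \<open>cover_LNode\<close> and
  \<open>cover_MNode\<close> presuppose \<open>hag_graph\<close>, which is itself derived from these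
  covers.\<close>

lemma cover_F_LNode:
  assumes "u \<in> pverts G"
  shows "cover F (LNode u) = {LNode u}"
proof -
  have "w = LNode u" if "w \<rightarrow>\<^sup>*\<^bsub>with_proj F\<^esub> LNode u" for w
    using that unfolding reachable_def by (cases rule: rtrancl_on.cases) auto
  then show ?thesis
    using assms by (auto simp: cover_def reachable_def pverts_F)
qed

lemma cover_F_MNode:
  assumes "i \<in> I"
  shows "cover F (MNode i) = LNode ` c i"
proof -
  have "w = LNode u" if "w \<rightarrow>\<^sup>*\<^bsub>with_proj F\<^esub> LNode u" for w u
    using that unfolding reachable_def by (cases rule: rtrancl_on.cases) auto
  moreover have "LNode u \<rightarrow>\<^sup>*\<^bsub>with_proj F\<^esub> MNode i" if "u \<in> c i" for u
    using that assms c_verts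
    by (auto simp: reachable_def pverts_F intro!: rtrancl_on_into_rtrancl_on[OF rtrancl_on_refl])
  moreover have "w \<in> LNode ` c i" if w: "w \<rightarrow>\<^sup>*\<^bsub>with_proj F\<^esub> MNode i" "w \<in> lefts F" for w
  proof -
    obtain y where "w \<rightarrow>\<^sup>*\<^bsub>with_proj F\<^esub> y" "(y, MNode i) \<in> parcs F"
      using w unfolding reachable_def by (cases rule: rtrancl_on.cases) auto
    then show ?thesis using calculation(1) by (auto elim!: arcs_F)
  qed
  ultimately show ?thesis using assms by (auto simp: cover_def dest: c_vertsD)
qed

text \<open>\<open>c_disjoint\<close> leaves at most one route through intermediate nodes from
  \<open>u\<close> to \<open>r\<close> and separates the covers; \<open>c_nbrs\<close> keeps their
  union inside the in-neighborhood, and \<open>c_inj\<close> makes the covers of intermediate nodes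
  distinct.\<close>

lemma hag_graph_F: "hag_graph G F"
proof -
  have sub: "parcs F \<subseteq> (lefts F \<union> mids F) \<times> (mids F \<union> rights F)"
  proof (rule subrelI)
    fix x y assume "(x, y) \<in> parcs F"
    then show "(x, y) \<in> (lefts F \<union> mids F) \<times> (mids F \<union> rights F)"
      by (cases rule: arcs_F) (auto dest: c_vertsD arcs_G)
  qed
  have path: "\<exists>!p. pre_digraph.apath (with_proj F) (LNode u) p (RNode r)" if "(u, r) \<in> parcs G" for u r
  proof (cases "\<exists>i \<in> I \<inter> s r. u \<in> c i")
    case True
    then obtain i where i: "i \<in> I" "i \<in> s r" "u \<in> c i" by blast
    show ?thesis
    proof (rule ex1I)
      show "pre_digraph.apath (with_proj F) (LNode u) [(LNode u, MNode i), (MNode i, RNode r)] (RNode r)"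
        using i arcs_G[OF \<open>(u, r) \<in> parcs G\<close>] by (auto simp: apath_F_iff)
    next
      fix p assume "pre_digraph.apath (with_proj F) (LNode u) p (RNode r)"
      then obtain j where j: "j \<in> I" "j \<in> s r" "u \<in> c j" "p = [(LNode u, MNode j), (MNode j, RNode r)]"
        using i by (auto simp: apath_F_iff)
      then have "j = i"
        using c_disjoint[of r i j] i arcs_G[OF \<open>(u, r) \<in> parcs G\<close>] by blast
      with j show "p = [(LNode u, MNode i), (MNode i, RNode r)]" by simp
    qed
  next
    case False
    then show ?thesis
      unfolding apath_F_iff using that
      by (intro ex1I[of _ "[(LNode u, RNode r)]"]) auto
  qed
  have disj: "cover F v \<inter> cover F w = {}"
    if r: "r \<in> pverts G" and vw: "v \<in> in_nbrs F (RNode r)" "w \<in> in_nbrs F (RNode r)" "v \<noteq> w" for r v w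
  proof -
    have L: "u \<in> pverts G" if "u \<in> nbrs G r" for u using that arcs_G by (auto simp: nbrs_def)
    \<comment> \<open>A left node in the cover of an in-neighbor \<open>x\<close> determines
      \<open>x\<close>: it is the feeding node whose set contains that left node or, if there is
      none, the left node itself.\<close>
    have mem: "\<exists>u. z = LNode u \<and> ((\<exists>i \<in> I \<inter> s r. x = MNode i \<and> u \<in> c i)
        \<or> x = LNode u \<and> u \<notin> (\<Union>i \<in> I \<inter> s r. c i))"
      if "x \<in> in_nbrs F (RNode r)" "z \<in> cover F x" for x z
      using that L by (auto simp: in_nbrs_F r cover_F_LNode cover_F_MNode)
    have False if z: "z \<in> cover F v" "z \<in> cover F w" for z
      using mem[OF vw(1) z(1)] mem[OF vw(2) z(2)] vw(3) c_disjoint[OF r] by (auto simp: disjoint_iff)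
    then show ?thesis by blast
  qed
  have un: "in_nbrs (gnn_graph G) (RNode r) = (\<Union>v \<in> in_nbrs F (RNode r). cover F v)"
    if r: "r \<in> pverts G" for r
  proof -
    have L: "u \<in> pverts G" if "u \<in> nbrs G r" for u using that arcs_G by (auto simp: nbrs_def)
    then have "(\<Union>v \<in> in_nbrs F (RNode r). cover F v)
        = (\<Union>i \<in> I \<inter> s r. LNode ` c i) \<union> LNode ` (nbrs G r - (\<Union>i \<in> I \<inter> s r. c i))"
      by (simp add: in_nbrs_F r cover_F_LNode cover_F_MNode
          UNION_singleton_eq_range)
    also have "\<dots> = LNode ` ((\<Union>i \<in> I \<inter> s r. c i) \<union> (nbrs G r - (\<Union>i \<in> I \<inter> s r. c i)))"
      by (simp only: image_Un image_UN)
    also have "\<dots> = LNode ` nbrs G r"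
      using c_nbrs[OF r] by (intro arg_cong[where f = "image LNode"]) auto
    finally show ?thesis by simp
  qed
  have "inj_on (cover F) (MNode ` I)"
    using c_inj by (auto simp: inj_on_def cover_F_MNode inj_image_eq_iff)
  then show ?thesis
    unfolding hag_graph_def using fin_F sub acyclic_F path disj un by simp
qed

lemma d_hag_graph_F: "(\<And>i. i \<in> I \<Longrightarrow> card (c i) = d) \<Longrightarrow> d_hag_graph G d F"
  using hag_graph_F by (auto simp: d_hag_graph_def in_nbrs_F)

lemma saving_F:
  assumes "r \<in> pverts G"
  shows "saving G F r = (\<Sum>i \<in> I \<inter> s r. real (card (c i)) - 1)"
proof -
  have "in_nbrs F (RNode r) \<inter> mids F = MNode ` (I \<inter> s r)"
    using assms by (auto simp: in_nbrs_F)
  then show ?thesis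
    using saving_eq_sum_mids[OF G hag_graph_F assms]
    by (simp add: sum.reindex inj_on_def cover_F_MNode)
qed

end

subsection \<open>Runs of the greedy algorithms\<close>

lemma full_greedy_flat_step:
  assumes "full_greedy G d i Cs (flat_graph G c s I)" and "j = Suc i" and "j \<notin> I"
    and "I' = insert j I" and "pair_fin_digraph G"
    and common: "common_rights (flat_graph G c s I) (LNode ` c j) = RNode ` {r \<in> pverts G. j \<in> s r}"
    and "candidate d (flat_graph G c s I) (LNode ` c j)"
    and "\<And>C. candidate d (flat_graph G c s I) C
      \<Longrightarrow> card (common_rights (flat_graph G c s I) C) \<le> card {r \<in> pverts G. j \<in> s r}"
  shows "full_greedy G d j (Cs @ [LNode ` c j]) (flat_graph G c s I')"
proof -
  have "is_arg_max (\<lambda>C. card (common_rights (flat_graph G c s I) C))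
      (candidate d (flat_graph G c s I)) (LNode ` c j)"
    using assms(7,8) by (auto simp: is_arg_max_def not_less common)
  then show ?thesis
    using full_greedy.step[OF assms(1)] add_mid_flat_graph[OF common assms(3,5)] assms(2,4)
    by metis
qed

section \<open>Existence of a step of PartialGreedy\<close>

lemma hag_value_Ints:
  assumes "cAgg \<noteq> 0" and "finite (pverts G)" and "d_hag_graph G d H"
  shows "hag_value cAgg cUp G H \<in> \<int>"
  unfolding hag_value_eq_savings[OF assms] saving_def
  by (intro Ints_diff Ints_sum Ints_mult) auto

text \<open>Minimizing the natural number \<open>b - f y\<close> yields a maximum of
  \<open>f\<close>. Applied to values of extensions, this avoids counting the graphs in
  \<open>extensions\<close>.\<close>

lemma ex_is_arg_max_bounded_Ints:
  fixes f :: "'a \<Rightarrow> real"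
  assumes "P x" and "\<And>y. P y \<Longrightarrow> f y \<in> \<int>" and "\<And>y. P y \<Longrightarrow> f y \<le> b"
  shows "\<exists>y. is_arg_max f P y"
proof -
  obtain y where y: "P y" "\<And>z. P z \<Longrightarrow> nat \<lfloor>b - f y\<rfloor> \<le> nat \<lfloor>b - f z\<rfloor>"
    using ex_has_least_nat[of P x "\<lambda>y. nat \<lfloor>b - f y\<rfloor>"] assms(1) by blast
  have "\<not> f y < f z" if z: "P z" for z
  proof
    assume less: "f y < f z"
    obtain k l where kl: "f y = of_int k" "f z = of_int l"
      using assms(2)[OF y(1)] assms(2)[OF z] by (auto elim!: Ints_cases)
    have "f z \<le> b" using assms(3)[OF z] .
    then show False using y(2)[OF z] less unfolding kl by (simp add: nat_le_eq_zle) linarith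
  qed
  with y(1) show ?thesis by (auto simp: is_arg_max_def)
qed

text \<open>To justify the choice of \<open>C\<close> it suffices to exhibit one extension
  \<open>H0\<close> for \<open>C\<close> whose value no extension for any candidate exceeds. The
  output may be a different graph of the same value, hence the existential conclusion.\<close>

lemma partial_greedy_stepI:
  assumes "cAgg \<noteq> 0" and "finite (pverts G)"
    and run: "partial_greedy cAgg cUp G d i Cs H" and j: "j = Suc i"
    and C: "candidate d H C" and H0: "H0 \<in> extensions G d H (MNode j) C"
    and best: "\<And>C' H'. candidate d H C' \<Longrightarrow> H' \<in> extensions G d H (MNode j) C'
      \<Longrightarrow> hag_value cAgg cUp G H' \<le> hag_value cAgg cUp G H0"
  shows "\<exists>H'. partial_greedy cAgg cUp G d j (Cs @ [C]) H'"
proof -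
  let ?val = "hag_value cAgg cUp G" and ?ext = "extensions G d H (MNode j)"
  have ex: "\<exists>H'. is_arg_max ?val (\<lambda>H'. H' \<in> ?ext C') H'"
    if C': "candidate d H C'" "?ext C' \<noteq> {}" for C'
  proof -
    obtain H1 where "H1 \<in> ?ext C'" using C'(2) by blast
    then show ?thesis
      using best[OF C'(1)] hag_value_Ints[OF assms(1,2)]
      by (intro ex_is_arg_max_bounded_Ints[where b = "?val H0"]) (auto simp: extensions_def)
  qed
  define opt where "opt C' = (SOME H'. is_arg_max ?val (\<lambda>H'. H' \<in> ?ext C') H')" for C'
  have opt: "is_arg_max ?val (\<lambda>H'. H' \<in> ?ext C') (opt C')"
    if "candidate d H C'" "?ext C' \<noteq> {}" for C'
    unfolding opt_def using ex[OF that] by (rule someI_ex)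
  have neC: "?ext C \<noteq> {}" using H0 by blast
  have "?val (opt C') \<le> ?val (opt C)" if C': "candidate d H C'" "?ext C' \<noteq> {}" for C'
  proof -
    have "?val (opt C') \<le> ?val H0"
      using opt[OF C'] best[OF C'(1)] by (auto simp: is_arg_max_def)
    also have "\<dots> \<le> ?val (opt C)"
      using opt[OF C neC] H0 by (auto simp: is_arg_max_def not_less)
    finally show ?thesis .
  qed
  then have "is_arg_max (\<lambda>C'. ?val (opt C')) (\<lambda>C'. candidate d H C' \<and> ?ext C' \<noteq> {}) C"
    using C neC by (auto simp: is_arg_max_def not_less)
  then have "partial_greedy cAgg cUp G d j (Cs @ [C]) (opt C)"
    using run opt unfolding j by (intro partial_greedy.step) auto
  then show ?thesis by blast
qed

text \<open>What PartialGreedy does next depends only on the part of its graph above the right-hand side,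
  and this part is determined by the sets chosen so far.\<close>

lemma partial_greedy_upper_part:
  assumes "partial_greedy cAgg cUp G d i Cs H"
  shows "lefts H = LNode ` pverts G \<and> mids H = MNode ` {1..i} \<and> length Cs = i
    \<and> mid_arcs H = (\<Union>j \<in> {1..i}. Cs ! (j - 1) \<times> {MNode j})"
  using assms
proof induction
  case start
  have "mid_arcs (gnn_graph G) = {}" by (simp add: mid_arcs_def)
  then show ?case by simp
next
  case (step i Cs H opt C)
  have "is_arg_max (hag_value cAgg cUp G) (\<lambda>H'. H' \<in> extensions G d H (MNode (Suc i)) C) (opt C)"
    using step.hyps by (auto simp: is_arg_max_def)
  then have ext: "opt C \<in> extensions G d H (MNode (Suc i)) C" by (simp add: is_arg_max_def)
  have *: "{1..Suc i} = insert (Suc i) {1..i}" by auto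
  \<comment> \<open>Intermediate nodes are labelled from 1 and lists are indexed from 0, hence
    \<open>j - 1\<close>; appending \<open>C\<close> leaves the first \<open>i\<close> entries
    unchanged.\<close>
  have "(\<Union>j \<in> {1..i}. (Cs @ [C]) ! (j - 1) \<times> {MNode j}) = (\<Union>j \<in> {1..i}. Cs ! (j - 1) \<times> {MNode j})"
    using step.IH by (intro SUP_cong) (auto simp: nth_append)
  then show ?case
    using ext step.IH unfolding *
    by (auto simp: extensions_def d_hag_graph_def hag_graph_def)
qed

lemma partial_greedy_last_step:
  assumes "partial_greedy cAgg cUp G d (Suc i) (Cs @ [C]) H'"
  obtains H where "partial_greedy cAgg cUp G d i Cs H"
    "is_arg_max (hag_value cAgg cUp G) (\<lambda>H'. H' \<in> extensions G d H (MNode (Suc i)) C) H'"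
  using assms
proof cases
  case (step Cs' H C' opt)
  then show thesis by (intro that[of H]) (auto simp: is_arg_max_def)
qed

subsection \<open>The example\<close>

declare One_nat_def [simp del]

text \<open>The in-neighborhood of size four sits at the extra vertex \<open>4\<close>, and those of
  size two, {A, B}, {C, D}, {B, C}, at \<open>2\<close>, \<open>1\<close>, \<open>3\<close>, which
  avoids loops. The right copy of \<open>0\<close> and the left copy of \<open>4\<close> are
  isolated.\<close>

definition G5 :: "nat pair_pre_digraph" where
  "G5 = \<lparr> pverts = {0, 1, 2, 3, 4},
          parcs = {(0, 4), (1, 4), (2, 4), (3, 4), (0, 2), (1, 2), (2, 1), (3, 1), (1, 3), (2, 3)} \<rparr>"

text \<open>Label \<open>3\<close> falls under the default, which also gives every other label a
  two-element set, so that \<open>card_chosen\<close> holds for all labels.\<close>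

definition chosen :: "nat \<Rightarrow> nat set" where
  "chosen i = (if i = 1 then {1, 2} else if i = 2 then {0, 1} else {2, 3})"

definition greedy_mids :: "nat \<Rightarrow> nat set" where
  "greedy_mids r = (if r = 4 \<or> r = 3 then {1} else if r = 2 then {2} else if r = 1 then {3} else {})"

text \<open>Only the right node \<open>4\<close> is served differently from
  \<open>greedy_mids\<close>; the arcs into intermediate nodes stay the same.\<close>

definition best_mids :: "nat \<Rightarrow> nat set" where
  "best_mids r = (if r = 4 then {2, 3} else greedy_mids r)"

abbreviation "greedy_graph \<equiv> flat_graph G5 chosen greedy_mids"
abbreviation "best_graph \<equiv> flat_graph G5 chosen best_mids {1, 2, 3}"

lemma pverts_G5 [simp]: "pverts G5 = {0, 1, 2, 3, 4}"
  by (simp add: G5_def)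

lemma parcs_G5: "(u, r) \<in> parcs G5 \<longleftrightarrow>
    r = 4 \<and> u \<in> {0, 1, 2, 3} \<or> r = 2 \<and> u \<in> {0, 1} \<or> r = 1 \<and> u \<in> {2, 3} \<or> r = 3 \<and> u \<in> {1, 2}"
  by (auto simp: G5_def)

lemma nbrs_G5 [simp]:
  "nbrs G5 0 = {}" "nbrs G5 1 = {2, 3}" "nbrs G5 2 = {0, 1}" "nbrs G5 3 = {1, 2}"
  "nbrs G5 4 = {0, 1, 2, 3}"
  by (auto simp: nbrs_def G5_def)

lemma chosen_simps [simp]:
  "chosen 1 = {1, 2}" "chosen 2 = {0, 1}" "chosen 3 = {2, 3}"
  by (auto simp: chosen_def)

lemma mids_simps [simp]:
  "greedy_mids 0 = {}" "greedy_mids 1 = {3}" "greedy_mids 2 = {2}" "greedy_mids 3 = {1}"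
  "greedy_mids 4 = {1}"
  "best_mids 0 = {}" "best_mids 1 = {3}" "best_mids 2 = {2}" "best_mids 3 = {1}"
  "best_mids 4 = {2, 3}"
  by (auto simp: greedy_mids_def best_mids_def)

lemma card_chosen: "card (chosen i) = 2"
  by (simp add: chosen_def)

lemma pair_digraph_G5: "pair_digraph G5"
  by unfold_locales (auto simp: G5_def)

lemma pair_fin_digraph_G5: "pair_fin_digraph G5"
  using pair_digraph_G5 by (simp add: pair_digraph_def)

lemma inj_on_chosen: "inj_on chosen {1, 2, 3}"
  by (simp add: doubleton_eq_iff)

lemma flat_hag_greedy:
  assumes "I \<subseteq> {1, 2, 3}"
  shows "flat_hag G5 chosen greedy_mids I"
proof (rule flat_hag.intro)
  show "finite I"
    by (rule finite_subset[OF assms]) simp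
  show "inj_on chosen I"
    by (rule inj_on_subset[OF inj_on_chosen assms])
qed (use assms pair_fin_digraph_G5 in \<open>auto simp: chosen_def greedy_mids_def split: if_splits\<close>)

lemma flat_hag_best: "flat_hag G5 chosen best_mids {1, 2, 3}"
proof (rule flat_hag.intro)
  show "inj_on chosen {1, 2, 3}"
    by (rule inj_on_chosen)
qed (use pair_fin_digraph_G5 in auto)

lemma d_hag_greedy: "I \<subseteq> {1, 2, 3} \<Longrightarrow> d_hag_graph G5 2 (greedy_graph I)"
  by (intro flat_hag.d_hag_graph_F flat_hag_greedy card_chosen)

lemma d_hag_best: "d_hag_graph G5 2 best_graph"
  by (intro flat_hag.d_hag_graph_F flat_hag_best card_chosen)

lemma hag_value_G5:
  assumes "cAgg \<noteq> 0" "d_hag_graph G5 2 H"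
  shows "hag_value cAgg cUp G5 H
    = saving G5 H 0 + saving G5 H 1 + saving G5 H 2 + saving G5 H 3 + saving G5 H 4
      - real (card (mids H))"
  using hag_value_eq_savings[OF assms(1) _ assms(2)] by simp

text \<open>The first intermediate node saves two arcs and costs one; each later one saves one and
  costs one.\<close>

lemma hag_value_greedy:
  assumes "cAgg \<noteq> 0"
  shows "hag_value cAgg cUp G5 (greedy_graph {1}) = 1"
    "hag_value cAgg cUp G5 (greedy_graph {1, 2}) = 1"
    "hag_value cAgg cUp G5 (greedy_graph {1, 2, 3}) = 1"
  by (simp_all add: hag_value_G5[OF assms d_hag_greedy] flat_hag.saving_F[OF flat_hag_greedy]
      Int_insert_left)

text \<open>Two arcs are saved at the right node \<open>4\<close> and one at each of
  \<open>1\<close>, \<open>2\<close>, \<open>3\<close>, while the three intermediate nodes cost one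
  each.\<close>

lemma hag_value_best:
  assumes "cAgg \<noteq> 0"
  shows "hag_value cAgg cUp G5 best_graph = 2"
  by (simp add: hag_value_G5[OF assms d_hag_best] flat_hag.saving_F[OF flat_hag_best]
      Int_insert_left card_chosen)

section \<open>Maximality of the choices of FullGreedy on the example\<close>

lemma common_rights_greedy:
  "common_rights (greedy_graph {}) (LNode ` chosen 1) = RNode ` {r \<in> pverts G5. 1 \<in> greedy_mids r}"
  "common_rights (greedy_graph {1}) (LNode ` chosen 2) = RNode ` {r \<in> pverts G5. 2 \<in> greedy_mids r}"
  "common_rights (greedy_graph {1, 2}) (LNode ` chosen 3) = RNode ` {r \<in> pverts G5. 3 \<in> greedy_mids r}"
  by (auto simp: common_rights_def out_nbrs_def parcs_G5)

text \<open>For \<open>d = 2\<close>, \<open>common_rights\<close> comes from the intersection of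
  two such sets, so maximality becomes a check over pairs of entries in the tables below.\<close>

definition right_nbrs :: "'v cgraph \<Rightarrow> 'v node \<Rightarrow> 'v set" where
  "right_nbrs H x = {r. RNode r \<in> rights H \<and> (x, RNode r) \<in> parcs H}"

lemma common_rights_pair: "common_rights H {x, y} = RNode ` (right_nbrs H x \<inter> right_nbrs H y)"
  by (auto simp: common_rights_def out_nbrs_def right_nbrs_def rights_def)

lemma right_nbrs_0:
  "right_nbrs (greedy_graph {}) (LNode 0) = {2, 4}"
  "right_nbrs (greedy_graph {}) (LNode 1) = {2, 3, 4}"
  "right_nbrs (greedy_graph {}) (LNode 2) = {1, 3, 4}"
  "right_nbrs (greedy_graph {}) (LNode 3) = {1, 4}"
  "right_nbrs (greedy_graph {}) (LNode 4) = {}"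
  by (auto simp: right_nbrs_def parcs_G5)

lemma right_nbrs_1:
  "right_nbrs (greedy_graph {1}) (LNode 0) = {2, 4}"
  "right_nbrs (greedy_graph {1}) (LNode 1) = {2}"
  "right_nbrs (greedy_graph {1}) (LNode 2) = {1}"
  "right_nbrs (greedy_graph {1}) (LNode 3) = {1, 4}"
  "right_nbrs (greedy_graph {1}) (LNode 4) = {}"
  "right_nbrs (greedy_graph {1}) (MNode 1) = {3, 4}"
  by (auto simp: right_nbrs_def parcs_G5)

lemma right_nbrs_2:
  "right_nbrs (greedy_graph {1, 2}) (LNode 0) = {4}"
  "right_nbrs (greedy_graph {1, 2}) (LNode 1) = {}"
  "right_nbrs (greedy_graph {1, 2}) (LNode 2) = {1}"
  "right_nbrs (greedy_graph {1, 2}) (LNode 3) = {1, 4}"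
  "right_nbrs (greedy_graph {1, 2}) (LNode 4) = {}"
  "right_nbrs (greedy_graph {1, 2}) (MNode 1) = {3, 4}"
  "right_nbrs (greedy_graph {1, 2}) (MNode 2) = {2}"
  by (auto simp: right_nbrs_def parcs_G5)

lemma candidate_pair:
  assumes "candidate 2 H C"
  obtains x y where "C = {x, y}" "x \<noteq> y" "x \<in> lefts H \<union> mids H" "y \<in> lefts H \<union> mids H"
  using assms unfolding candidate_def by (auto simp: card_2_iff)

lemma common_rights_max_0:
  assumes "candidate 2 (greedy_graph {}) C"
  shows "card (common_rights (greedy_graph {}) C) \<le> 2"
proof -
  obtain x y where C: "C = {x, y}" "x \<noteq> y"
    and "x \<in> {LNode 0, LNode 1, LNode 2, LNode 3, LNode 4}"
    and "y \<in> {LNode 0, LNode 1, LNode 2, LNode 3, LNode 4}"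
    using assms by (rule candidate_pair) auto
  \<comment> \<open>In this case check \<open>x \<noteq> y\<close> matters: the left nodes
    \<open>1\<close> and \<open>2\<close> have three right neighbors each.\<close>
  then have "card (right_nbrs (greedy_graph {}) x \<inter> right_nbrs (greedy_graph {}) y) \<le> 2"
    by (elim insertE emptyE) (simp_all add: right_nbrs_0)
  then show ?thesis by (simp add: C common_rights_pair)
qed

lemma common_rights_max_1:
  assumes "candidate 2 (greedy_graph {1}) C"
  shows "card (common_rights (greedy_graph {1}) C) \<le> 1"
proof -
  obtain x y where C: "C = {x, y}" "x \<noteq> y"
    and "x \<in> {LNode 0, LNode 1, LNode 2, LNode 3, LNode 4, MNode 1}"
    and "y \<in> {LNode 0, LNode 1, LNode 2, LNode 3, LNode 4, MNode 1}"
    using assms by (rule candidate_pair) auto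
  then have "card (right_nbrs (greedy_graph {1}) x \<inter> right_nbrs (greedy_graph {1}) y) \<le> 1"
    by (elim insertE emptyE) (simp_all only: right_nbrs_1, simp_all)
  then show ?thesis by (simp add: C common_rights_pair)
qed

lemma common_rights_max_2:
  assumes "candidate 2 (greedy_graph {1, 2}) C"
  shows "card (common_rights (greedy_graph {1, 2}) C) \<le> 1"
proof -
  obtain x y where C: "C = {x, y}" "x \<noteq> y"
    and "x \<in> {LNode 0, LNode 1, LNode 2, LNode 3, LNode 4, MNode 1, MNode 2}"
    and "y \<in> {LNode 0, LNode 1, LNode 2, LNode 3, LNode 4, MNode 1, MNode 2}"
    using assms by (rule candidate_pair) auto
  then have "card (right_nbrs (greedy_graph {1, 2}) x \<inter> right_nbrs (greedy_graph {1, 2}) y) \<le> 1"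
    by (elim insertE emptyE) (simp_all only: right_nbrs_2, simp_all)
  then show ?thesis by (simp add: C common_rights_pair)
qed

section \<open>Upper bounds for the value on the example\<close>

lemma hag_value_G5_le_2:
  assumes "cAgg \<noteq> 0" and H: "d_hag_graph G5 2 H"
  shows "hag_value cAgg cUp G5 H \<le> 2"
proof -
  have hag: "hag_graph G5 H" using H by (simp add: d_hag_graph_def)
  define a where "a r = card (in_nbrs H (RNode r))" for r
  define S where "S = {r \<in> {1, 2, 3, 4}. a r = 1}"
  have pos: "a 1 \<ge> 1" "a 2 \<ge> 1" "a 3 \<ge> 1" "a 4 \<ge> 1"
    using in_nbrs_nonempty[OF pair_fin_digraph_G5 hag] by (simp_all add: a_def)
  have "inj_on (nbrs G5) {1, 2, 3, 4}"
    by (simp add: set_eq_subset)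
  then have inj: "inj_on (nbrs G5) S"
    by (rule inj_on_subset) (auto simp: S_def)
  have "card (nbrs G5 r) \<ge> 2 \<and> card (in_nbrs H (RNode r)) = 1" if "r \<in> S" for r
    using that by (auto simp: S_def a_def)
  then have "card S \<le> card (mids H)"
    by (rule card_single_in_nbr_le[OF pair_fin_digraph_G5 hag inj, rotated]) (auto simp: S_def)
  moreover have "card S = (\<Sum>r \<in> {1, 2, 3, 4}. if a r = 1 then 1 else 0)"
    unfolding S_def by (simp only: card_eq_sum) (rule sum.inter_filter, simp)
  ultimately have "(if a 1 = 1 then 1 else 0) + (if a 2 = 1 then 1 else 0) + (if a 3 = 1 then 1 else 0)
      + (if a 4 = 1 then 1 else 0) \<le> real (card (mids H))"
    by (simp split: if_splits)
  \<comment> \<open>A right node with two in-neighbors saves \<open>2 - a r\<close> arcs, which is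
    positive only for \<open>a r = 1\<close>.\<close>
  moreover have "saving G5 H r \<le> (if a r = 1 then 1 else 0)" if "r \<in> {1, 2, 3}" for r
    using that pos by (auto simp: saving_def a_def)
  from this[of 1] this[of 2] this[of 3]
  have "saving G5 H 1 \<le> (if a 1 = 1 then 1 else 0)" "saving G5 H 2 \<le> (if a 2 = 1 then 1 else 0)"
    "saving G5 H 3 \<le> (if a 3 = 1 then 1 else 0)" by simp_all
  \<comment> \<open>The saving is \<open>4 - a 4\<close>: three arcs if one in-arc is left, at most
    two otherwise.\<close>
  moreover have "saving G5 H 4 \<le> 2 + (if a 4 = 1 then 1 else 0)"
    using pos by (auto simp: saving_def a_def)
  moreover have "saving G5 H 0 \<le> 0" by (simp add: saving_def)
  \<comment> \<open>The savings add up to at most \<open>2 + card S\<close>, and at least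
    \<open>card S\<close> is subtracted for the intermediate nodes.\<close>
  ultimately show ?thesis
    unfolding hag_value_G5[OF assms] by linarith
qed

text \<open>The new node has cover \<open>C\<close> and saves one arc at each right node it feeds,
  whose in-neighborhood must contain \<open>C\<close>. No pair lies in more than two
  in-neighborhoods, so the value is at most \<open>2 - 1\<close>.\<close>

lemma extension_value_le_1:
  assumes "cAgg \<noteq> 0" and C: "candidate 2 (gnn_graph G5) C"
    and ext: "H \<in> extensions G5 2 (gnn_graph G5) (MNode 1) C"
  shows "hag_value cAgg cUp G5 H \<le> 1"
proof -
  have H: "d_hag_graph G5 2 H" and hag: "hag_graph G5 H" and M: "mids H = {MNode 1}"
    and arcs: "mid_arcs H = C \<times> {MNode 1}"
    using ext by (auto simp: extensions_def d_hag_graph_def mid_arcs_def)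
  have L: "lefts H = LNode ` pverts G5" using hag by (simp add: hag_graph_def)
  have CL: "C \<subseteq> lefts H" "card C = 2" using C by (auto simp: candidate_def L)
  have "in_nbrs H (MNode 1) = C" using in_nbrs_mid[OF hag] by (simp add: M arcs)
  then have "cover H (MNode 1) = (\<Union>v \<in> C. cover H v)" using cover_MNode[OF hag] by (simp add: M)
  also have "\<dots> = (\<Union>v \<in> C. {v})"
    using CL cover_LNode[OF hag] by (intro SUP_cong) (auto simp: L)
  finally have cov: "cover H (MNode 1) = C" by simp
  have sav: "saving G5 H r \<le> (if C \<subseteq> LNode ` nbrs G5 r then 1 else 0)" if r: "r \<in> pverts G5" for r
  proof (cases "MNode 1 \<in> in_nbrs H (RNode r)")
    case True
    then have "C \<subseteq> LNode ` nbrs G5 r"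
      using Union_cover_in_nbrs[OF pair_fin_digraph_G5 hag r] cov by blast
    then show ?thesis
      using saving_eq_sum_mids[OF pair_fin_digraph_G5 hag r] True by (simp add: M cov CL(2))
  next
    case False
    then show ?thesis
      using saving_eq_sum_mids[OF pair_fin_digraph_G5 hag r] by (simp add: M)
  qed
  obtain v w where "C = {v, w}" "v \<noteq> w" using CL(2) by (auto simp: card_2_iff)
  moreover from this obtain x y where "v = LNode x" "w = LNode y"
    using CL(1) unfolding L by blast
  ultimately have xy: "C = {LNode x, LNode y}" "x \<noteq> y" by auto
  have sub: "C \<subseteq> LNode ` A \<longleftrightarrow> x \<in> A \<and> y \<in> A" for A
    using xy by auto
  have "x \<in> {0, 1, 2, 3, 4}" "y \<in> {0, 1, 2, 3, 4}" using CL(1) by (auto simp: xy L)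
  then have "(\<Sum>r \<in> pverts G5. if x \<in> nbrs G5 r \<and> y \<in> nbrs G5 r then 1 else (0 :: real)) \<le> 2"
    using xy(2) by (elim insertE emptyE) simp_all
  moreover have "(\<Sum>r \<in> pverts G5. saving G5 H r)
      \<le> (\<Sum>r \<in> pverts G5. if x \<in> nbrs G5 r \<and> y \<in> nbrs G5 r then 1 else (0 :: real))"
    using sav unfolding sub by (intro sum_mono) auto
  ultimately show ?thesis
    using hag_value_eq_savings[OF assms(1) _ H] by (simp add: M)
qed

text \<open>Value \<open>2\<close> would require at most six in-arcs at the four right nodes. As the first intermediate
  node covers \<open>{B, C}\<close>, the second one would have to cover \<open>{A, B}\<close> or \<open>{C, D}\<close>, and then both together
  would have to feed the right node with four in-neighbors. But their covers intersect.\<close>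

lemma second_extension_value_le_1:
  assumes "cAgg \<noteq> 0" and H0: "mids H0 = {MNode 1}" "mid_arcs H0 = (LNode ` {1, 2}) \<times> {MNode 1}"
    and "lefts H0 = LNode ` pverts G5" and C: "candidate 2 H0 C"
    and ext: "H \<in> extensions G5 2 H0 (MNode 2) C"
  shows "hag_value cAgg cUp G5 H \<le> 1"
proof -
  note G = pair_fin_digraph_G5
  have H: "d_hag_graph G5 2 H" and hag: "hag_graph G5 H" and M: "mids H = {MNode 1, MNode 2}"
    and arcs: "mid_arcs H = (LNode ` {1, 2}) \<times> {MNode 1} \<union> C \<times> {MNode 2}"
    using ext H0 by (auto simp: extensions_def d_hag_graph_def)
  have L: "lefts H = LNode ` pverts G5" using hag by (simp add: hag_graph_def)
  have CL: "C \<subseteq> lefts H \<union> {MNode 1}" "card C = 2"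
    using C assms(4) H0 by (auto simp: candidate_def L)
  have "in_nbrs H (MNode 1) = {LNode 1, LNode 2}" and in2: "in_nbrs H (MNode 2) = C"
    using in_nbrs_mid[OF hag] by (auto simp: M arcs)
  then have cov1: "cover H (MNode 1) = LNode ` {1, 2}"
    using cover_MNode[OF hag, of "MNode 1"] cover_LNode[OF hag] by (auto simp: M L)
  have cov2: "cover H (MNode 2) = (\<Union>v \<in> C. cover H v)"
    using cover_MNode[OF hag] in2 by (simp add: M)
  have card1: "card (cover H (MNode 1)) = 2" by (simp add: cov1 del: image_insert)
  \<comment> \<open>At most one element of \<open>C\<close> is \<open>MNode 1\<close>, which covers
    two nodes; the others are left nodes.\<close>
  have card2: "card (cover H (MNode 2)) \<le> 3"
  proof -
    obtain x y where xy: "C = {x, y}" "x \<noteq> y" using CL(2) by (auto simp: card_2_iff)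
    then have "x \<in> lefts H \<or> y \<in> lefts H" using CL(1) by auto
    moreover have "card (cover H v) \<le> 2" "v \<in> lefts H \<Longrightarrow> card (cover H v) = 1" if "v \<in> C" for v
      using that CL(1) card_cover_left[OF G hag] card1 by force+
    ultimately have "card (cover H x) + card (cover H y) \<le> 3"
      using xy by fastforce
    then show ?thesis
      unfolding cov2 xy using card_Un_le[of "cover H x" "cover H y"] by simp
  qed
  define a where "a r = card (in_nbrs H (RNode r))" for r
  have pos: "a 1 \<ge> 1" "a 2 \<ge> 1" "a 3 \<ge> 1" "a 4 \<ge> 1"
    using in_nbrs_nonempty[OF G hag] by (simp_all add: a_def)
  \<comment> \<open>\<open>MNode 1\<close> covers {B, C}, which is not the in-neighborhood of
    \<open>1\<close>, \<open>2\<close> or \<open>4\<close>, so a single source there must be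
    \<open>MNode 2\<close>.\<close>
  have single: "cover H (MNode 2) = LNode ` nbrs G5 r" if r: "a r = 1" "r \<in> {1, 2, 4}" for r
  proof -
    have "r \<in> pverts G5" "card (nbrs G5 r) \<ge> 2" using r(2) by auto
    then obtain m where m: "m \<in> mids H" "cover H m = LNode ` nbrs G5 r"
      using single_in_nbr[OF G hag, of r] r(1) unfolding a_def by blast
    have "cover H (MNode 1) \<noteq> LNode ` nbrs G5 r"
      using r(2) unfolding cov1 by (elim insertE emptyE) (simp_all add: set_eq_subset)
    then show ?thesis using m by (auto simp: M)
  qed
  have a4: "a 4 \<ge> 2"
  proof (rule ccontr)
    assume "\<not> a 4 \<ge> 2"
    then have "cover H (MNode 2) = LNode ` nbrs G5 4" using pos by (intro single) auto
    then have "card (cover H (MNode 2)) = card (nbrs G5 4)" by (simp only: card_image_LNode)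
    then show False using card2 by simp
  qed
  have a12: "a 1 + a 2 \<ge> 3"
  proof (rule ccontr)
    assume "\<not> a 1 + a 2 \<ge> 3"
    then have "a 1 = 1" "a 2 = 1" using pos by auto
    then have "LNode ` nbrs G5 1 = LNode ` nbrs G5 2" using single[of 1] single[of 2] by simp
    then show False by (simp add: set_eq_subset)
  qed
  have "a 1 + a 2 + a 3 + a 4 \<ge> 7"
  proof (rule ccontr)
    assume "\<not> a 1 + a 2 + a 3 + a 4 \<ge> 7"
    \<comment> \<open>With \<open>a 3 \<ge> 1\<close>, the bounds \<open>a4\<close> and
      \<open>a12\<close> already add up to six, so both are attained.\<close>
    then have eq: "a 4 = 2" "a 1 = 1 \<or> a 2 = 1" using a4 a12 pos by auto
    have cov2': "cover H (MNode 2) = LNode ` {2, 3} \<or> cover H (MNode 2) = LNode ` {0, 1}"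
      using eq(2) single[of 1] single[of 2] by (elim disjE) simp_all
    obtain x y where xy: "in_nbrs H (RNode 4) = {x, y}" "x \<noteq> y"
      using eq(1) unfolding a_def by (auto simp: card_2_iff)
    have sum: "card (cover H x) + card (cover H y) = 4"
      using card_nbrs[OF G hag, of 4] xy by simp
    have "card (cover H (MNode 2)) = 2"
      using cov2' by (elim disjE) (simp_all del: image_insert)
    then have le: "card (cover H v) = (if v \<in> lefts H then 1 else 2)" if "v \<in> {x, y}" for v
      using in_nbrs_subset[OF G hag, of "RNode 4"] that xy(1) card1 card_cover_left[OF G hag, of v]
      by (auto simp: M L)
    \<comment> \<open>Intermediate nodes now cover two nodes each and left nodes one, so a total of
      four excludes left nodes.\<close>
    have "x \<notin> lefts H" "y \<notin> lefts H" using le[of x] le[of y] sum by (auto split: if_splits)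
    then have "x \<in> mids H" "y \<in> mids H"
      using in_nbrs_subset[OF G hag, of "RNode 4"] xy(1) by auto
    then have "{x, y} = {MNode 1, MNode 2}" using xy(2) by (auto simp: M)
    then have "cover H (MNode 1) \<inter> cover H (MNode 2) = {}"
      using cover_in_nbrs_disjoint[OF G hag, of 4 "MNode 1" "MNode 2"] xy(1) by simp
    then show False using cov2' unfolding cov1 by auto
  qed
  \<comment> \<open>The right nodes \<open>1\<close> to \<open>4\<close> have ten in-arcs in the GNN
    computation graph. With at least seven remaining and two intermediate nodes, the value is at
    most \<open>10 - 7 - 2\<close>.\<close>
  then have "real (a 1) + real (a 2) + real (a 3) + real (a 4) \<ge> 7" by linarith
  then show ?thesis
    unfolding hag_value_G5[OF assms(1) H] by (simp add: saving_def a_def M)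
qed

section \<open>Runs of both algorithms on the example\<close>

lemma card_greedy_mids_served:
  "card {r \<in> pverts G5. 1 \<in> greedy_mids r} = 2"
  "card {r \<in> pverts G5. 2 \<in> greedy_mids r} = 1"
  "card {r \<in> pverts G5. 3 \<in> greedy_mids r} = 1"
proof -
  have "{r \<in> pverts G5. 1 \<in> greedy_mids r} = {3, 4}"
    "{r \<in> pverts G5. 2 \<in> greedy_mids r} = {2}" "{r \<in> pverts G5. 3 \<in> greedy_mids r} = {1}"
    by (auto simp: greedy_mids_def split: if_splits)
  then show "card {r \<in> pverts G5. 1 \<in> greedy_mids r} = 2"
    "card {r \<in> pverts G5. 2 \<in> greedy_mids r} = 1" "card {r \<in> pverts G5. 3 \<in> greedy_mids r} = 1"
    by (simp_all del: pverts_G5)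
qed

lemma candidate_chosen:
  "lefts H = LNode ` pverts G5 \<Longrightarrow> candidate 2 H (LNode ` chosen i)"
  unfolding candidate_def by (simp only: card_image_LNode card_chosen) (auto simp: chosen_def)

text \<open>The maxima are 2, 1, 1. Other pairs tie in every iteration, so this is one of several
  admissible runs.\<close>

lemma full_greedy_G5:
  "full_greedy G5 2 3 [LNode ` chosen 1, LNode ` chosen 2, LNode ` chosen 3] (greedy_graph {1, 2, 3})"
proof -
  have "full_greedy G5 2 0 [] (greedy_graph {})"
    unfolding flat_graph_empty by (rule full_greedy.start)
  then have "full_greedy G5 2 1 ([] @ [LNode ` chosen 1]) (greedy_graph {1})"
    by (rule full_greedy_flat_step[OF _ _ _ _ pair_fin_digraph_G5 common_rights_greedy(1)
          candidate_chosen])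
      (use common_rights_max_0 in \<open>simp_all add: card_greedy_mids_served del: pverts_G5\<close>)
  then have "full_greedy G5 2 2 ([LNode ` chosen 1] @ [LNode ` chosen 2]) (greedy_graph {1, 2})"
    unfolding append_Nil
    by (rule full_greedy_flat_step[OF _ _ _ _ pair_fin_digraph_G5 common_rights_greedy(2)
          candidate_chosen])
      (use common_rights_max_1 in \<open>simp_all add: card_greedy_mids_served insert_commute del: pverts_G5\<close>)
  then have "full_greedy G5 2 2 [LNode ` chosen 1, LNode ` chosen 2] (greedy_graph {1, 2})"
    by (simp only: append_Cons append_Nil)
  then have "full_greedy G5 2 3 ([LNode ` chosen 1, LNode ` chosen 2] @ [LNode ` chosen 3])
      (greedy_graph {1, 2, 3})"
    by (rule full_greedy_flat_step[OF _ _ _ _ pair_fin_digraph_G5 common_rights_greedy(3)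
          candidate_chosen])
      (use common_rights_max_2 in \<open>simp_all add: card_greedy_mids_served insert_commute del: pverts_G5\<close>)
  then show ?thesis by (simp only: append_Cons append_Nil)
qed

text \<open>The choice of \<open>C\<close> is the only freedom in an iteration, so the list of
  chosen sets determines the output.\<close>

lemma full_greedy_unique:
  assumes "full_greedy G d i Cs H" and "full_greedy G d j Cs H'"
  shows "H = H'"
  using assms
proof (induction arbitrary: j H')
  case start
  then show ?case by (cases rule: full_greedy.cases) auto
next
  case (step i Cs H C)
  \<comment> \<open>The list length is the number of iterations, so both runs give the new node the
    same label.\<close>
  have len: "length Ds = k" if "full_greedy G d k Ds K" for k Ds K
    using that by induction auto
  from step.prems obtain H1 k where "full_greedy G d k Cs H1" "H' = add_mid H1 (MNode (Suc k)) C"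
    by (cases rule: full_greedy.cases) auto
  then show ?case using step.IH len[OF step.hyps(1)] len by blast
qed

lemma mid_arcs_chosen:
  "mid_arcs (flat_graph G5 chosen s I) = (\<Union>i \<in> I. (LNode ` chosen i) \<times> {MNode i})"
  by (rule mid_arcs_flat_graph) (auto simp: chosen_def)

lemma optimal_hag_G5_iff:
  assumes "cAgg \<noteq> 0"
  shows "optimal_hag cAgg cUp G5 2 3 H \<longleftrightarrow> feasible_hag G5 2 3 H \<and> hag_value cAgg cUp G5 H = 2"
proof -
  have "feasible_hag G5 2 3 best_graph"
    using d_hag_best by (simp add: feasible_hag_def)
  moreover have "hag_value cAgg cUp G5 H' \<le> 2" if "feasible_hag G5 2 3 H'" for H'
    using that hag_value_G5_le_2[OF assms] by (simp add: feasible_hag_def)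
  ultimately show ?thesis
    using hag_value_best[OF assms, of cUp]
    by (simp add: optimal_hag_def is_arg_max_def not_less) (metis antisym)
qed

text \<open>An extension has to preserve only the arcs into intermediate nodes, and these are known
  for every \<open>H\<close>. The arcs into the right-hand side may all change, in particular the
  one from \<open>MNode 1\<close> to the right node \<open>4\<close>.\<close>

lemma best_graph_extension:
  assumes "partial_greedy cAgg cUp G5 2 2 [LNode ` chosen 1, LNode ` chosen 2] H"
  shows "best_graph \<in> extensions G5 2 H (MNode 3) (LNode ` chosen 3)"
proof -
  have "{1..2} = {1, 2 :: nat}" by auto
  then have "mids H = {MNode 1, MNode 2}"
    "mid_arcs H = (LNode ` chosen 1) \<times> {MNode 1} \<union> (LNode ` chosen 2) \<times> {MNode 2}"
    using partial_greedy_upper_part[OF assms] by (simp_all del: chosen_simps)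
  then show ?thesis
    using d_hag_best by (auto simp: extensions_def mid_arcs_chosen)
qed

lemma partial_greedy_G5:
  assumes "cAgg \<noteq> 0"
  shows "\<exists>H. partial_greedy cAgg cUp G5 2 3 [LNode ` chosen 1, LNode ` chosen 2, LNode ` chosen 3] H"
proof -
  note step = partial_greedy_stepI[OF assms pair_fin_digraph.pair_finite_verts[OF pair_fin_digraph_G5]]
  have H0: "partial_greedy cAgg cUp G5 2 0 [] (gnn_graph G5)"
    by (rule partial_greedy.start)
  \<comment> \<open>This graph attains the bound of \<open>extension_value_le_1\<close>, which makes
    the first choice admissible.\<close>
  have ext0: "greedy_graph {1} \<in> extensions G5 2 (gnn_graph G5) (MNode 1) (LNode ` chosen 1)"
    using d_hag_greedy[of "{1}"]
    by (auto simp: extensions_def mid_arcs_chosen simp flip: flat_graph_empty[of _ chosen greedy_mids])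
  have cand0: "candidate 2 (gnn_graph G5) (LNode ` chosen 1)"
    by (rule candidate_chosen) (rule gnn_graph_simps)
  have "\<exists>H. partial_greedy cAgg cUp G5 2 1 ([] @ [LNode ` chosen 1]) H"
    by (rule step[OF H0 _ cand0 ext0])
      (simp add: One_nat_def, simp only: hag_value_greedy(1)[OF assms] extension_value_le_1[OF assms])
  then obtain H1 where H1: "partial_greedy cAgg cUp G5 2 1 [LNode ` chosen 1] H1"
    by (auto simp del: chosen_simps)
  \<comment> \<open>\<open>H1\<close> need not be \<open>greedy_graph {1}\<close>; only its upper
    part is used from here on.\<close>
  have up1: "lefts H1 = LNode ` pverts G5" "mids H1 = {MNode 1}"
    "mid_arcs H1 = (LNode ` {1, 2}) \<times> {MNode 1}"
    using partial_greedy_upper_part[OF H1] by simp_all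
  have ext1: "greedy_graph {1, 2} \<in> extensions G5 2 H1 (MNode 2) (LNode ` chosen 2)"
    using d_hag_greedy[of "{1, 2}"] by (auto simp: extensions_def up1 mid_arcs_chosen)
  have cand1: "candidate 2 H1 (LNode ` chosen 2)"
    by (rule candidate_chosen) (rule up1)
  have "\<exists>H. partial_greedy cAgg cUp G5 2 2 ([LNode ` chosen 1] @ [LNode ` chosen 2]) H"
    by (rule step[OF H1 _ cand1 ext1])
      (simp, simp only: hag_value_greedy(2)[OF assms]
        second_extension_value_le_1[OF assms up1(2,3,1)])
  then obtain H2 where H2: "partial_greedy cAgg cUp G5 2 2 [LNode ` chosen 1, LNode ` chosen 2] H2"
    by (auto simp del: chosen_simps)
  have cand2: "candidate 2 H2 (LNode ` chosen 3)"
    using partial_greedy_upper_part[OF H2] by (intro candidate_chosen) simp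
  have "\<exists>H. partial_greedy cAgg cUp G5 2 3
      ([LNode ` chosen 1, LNode ` chosen 2] @ [LNode ` chosen 3]) H"
    by (rule step[OF H2 _ cand2 best_graph_extension[OF H2]])
      (use hag_value_G5_le_2[OF assms, of _ cUp] hag_value_best[OF assms, of cUp]
        in \<open>auto simp: extensions_def simp del: chosen_simps\<close>)
  then show ?thesis by (simp only: append_Cons append_Nil)
qed

text \<open>The last iteration returns a best extension, and \<open>best_graph\<close> is among the
  extensions. So the value is at least 2, and \<open>hag_value_G5_le_2\<close> gives
  equality.\<close>

lemma partial_greedy_G5_optimal:
  assumes "cAgg \<noteq> 0"
    and "partial_greedy cAgg cUp G5 2 3 [LNode ` chosen 1, LNode ` chosen 2, LNode ` chosen 3] H"
  shows "optimal_hag cAgg cUp G5 2 3 H"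
proof -
  have "partial_greedy cAgg cUp G5 2 (Suc 2) ([LNode ` chosen 1, LNode ` chosen 2] @ [LNode ` chosen 3]) H"
    using assms(2) by (simp del: chosen_simps)
  then obtain H2 where H2: "partial_greedy cAgg cUp G5 2 2 [LNode ` chosen 1, LNode ` chosen 2] H2"
    and arg_max: "is_arg_max (hag_value cAgg cUp G5)
      (\<lambda>H'. H' \<in> extensions G5 2 H2 (MNode (Suc 2)) (LNode ` chosen 3)) H"
    by (rule partial_greedy_last_step)
  have 3: "Suc 2 = 3" by simp
  have ext: "H \<in> extensions G5 2 H2 (MNode 3) (LNode ` chosen 3)"
    and "hag_value cAgg cUp G5 best_graph \<le> hag_value cAgg cUp G5 H"
    using arg_max best_graph_extension[OF H2] unfolding 3 by (auto simp: is_arg_max_def not_less)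
  moreover have d: "d_hag_graph G5 2 H" using ext by (simp add: extensions_def)
  ultimately have "hag_value cAgg cUp G5 H = 2"
    using hag_value_G5_le_2[OF assms(1) d] hag_value_best[OF assms(1)] by (metis antisym)
  moreover have "mids H = MNode ` {1..3}"
    using partial_greedy_upper_part[OF assms(2)] by simp
  then have "card (mids H) = 3" by (simp only: card_image_MNode) simp
  ultimately show ?thesis
    using d by (simp add: optimal_hag_G5_iff[OF assms(1)] feasible_hag_def)
qed

theorem mainTheorem5:
  fixes cAgg cUp :: real
  assumes "cAgg \<noteq> 0"
  shows "\<exists>(G :: nat pair_pre_digraph) A B C D.
    pair_digraph G \<and> {A, B, C, D} \<subseteq> lefts (gnn_graph G) \<and> distinct [A, B, C, D] \<and>
    (\<exists>H. full_greedy G 2 3 [{B, C}, {A, B}, {C, D}] H) \<and>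
    (\<forall>H. full_greedy G 2 3 [{B, C}, {A, B}, {C, D}] H \<longrightarrow>
       feasible_hag G 2 3 H \<and> hag_value cAgg cUp G H = 1) \<and>
    (\<exists>H. optimal_hag cAgg cUp G 2 3 H) \<and>
    (\<forall>H. optimal_hag cAgg cUp G 2 3 H \<longrightarrow> hag_value cAgg cUp G H = 2) \<and>
    (\<exists>H. partial_greedy cAgg cUp G 2 3 [{B, C}, {A, B}, {C, D}] H) \<and>
    (\<forall>H. partial_greedy cAgg cUp G 2 3 [{B, C}, {A, B}, {C, D}] H \<longrightarrow>
       optimal_hag cAgg cUp G 2 3 H \<and> hag_value cAgg cUp G H = 2)"
proof (rule exI[of _ G5], rule exI[of _ "LNode 0"], rule exI[of _ "LNode 1"],
    rule exI[of _ "LNode 2"], rule exI[of _ "LNode 3"], intro conjI)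
  have Cs: "[{LNode 1, LNode 2}, {LNode 0, LNode 1}, {LNode 2, LNode 3}]
      = [LNode ` chosen 1, LNode ` chosen 2, LNode ` chosen 3]"
    by simp
  show "pair_digraph G5"
    by (rule pair_digraph_G5)
  show "{LNode 0, LNode 1, LNode 2, LNode 3} \<subseteq> lefts (gnn_graph G5)"
    "distinct [LNode 0, LNode 1, LNode 2, LNode (3 :: nat)]"
    by simp_all
  show "\<exists>H. full_greedy G5 2 3 [{LNode 1, LNode 2}, {LNode 0, LNode 1}, {LNode 2, LNode 3}] H"
    unfolding Cs using full_greedy_G5 by blast
  have "feasible_hag G5 2 3 (greedy_graph {1, 2, 3})"
    using d_hag_greedy[of "{1, 2, 3}"] by (simp add: feasible_hag_def)
  then show "\<forall>H. full_greedy G5 2 3 [{LNode 1, LNode 2}, {LNode 0, LNode 1}, {LNode 2, LNode 3}] H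
      \<longrightarrow> feasible_hag G5 2 3 H \<and> hag_value cAgg cUp G5 H = 1"
    unfolding Cs using full_greedy_unique[OF full_greedy_G5] hag_value_greedy(3)[OF assms] by metis
  show "\<forall>H. optimal_hag cAgg cUp G5 2 3 H \<longrightarrow> hag_value cAgg cUp G5 H = 2"
    by (simp add: optimal_hag_G5_iff[OF assms])
  show "\<exists>H. partial_greedy cAgg cUp G5 2 3
      [{LNode 1, LNode 2}, {LNode 0, LNode 1}, {LNode 2, LNode 3}] H"
    unfolding Cs by (rule partial_greedy_G5[OF assms])
  \<comment> \<open>An optimal graph exists because the run of PartialGreedy outputs one.\<close>
  then show "\<exists>H. optimal_hag cAgg cUp G5 2 3 H"
    unfolding Cs using partial_greedy_G5_optimal[OF assms] by blast
  show "\<forall>H. partial_greedy cAgg cUp G5 2 3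
        [{LNode 1, LNode 2}, {LNode 0, LNode 1}, {LNode 2, LNode 3}] H
      \<longrightarrow> optimal_hag cAgg cUp G5 2 3 H \<and> hag_value cAgg cUp G5 H = 2"
    unfolding Cs using partial_greedy_G5_optimal[OF assms] optimal_hag_G5_iff[OF assms] by blast
qed

end
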